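(* Let $M\ge 1/4$, $0\le h<1/2$ and $a\in[-M,M]$. Consider the scalar system $x_{t+1}=ax_t+u_t+w_t+f_t$, $x_0=0$, with $|w_{0:t}|\le h|x_{0:t}|$ for all $t\in\mathbb Z_+$, controlled by the certainty equivalence controller $\mathcal A$ described in the context. Then $$\ell_2\text{-gain}(\mathcal A)\le\frac{(64M^2-8h)^{1/2}}{(1-2h)^{3/2}}.$$
   Context: All signals are real-valued; $\mathbb Z_+=\{0,1,2,\dots\}$. For a signal $y$, $|y_{s:t}|=\big(\sum_{r=s}^t y_r^2\big)^{1/2}$. The parameter $a\in[-M,M]$ is unknown to the controller, which knows $M$. The disturbance $f_t$ is arbitrary and $w_t$ is an arbitrary signal (model misspecification, may depend on past states) subject to $|w_{0:t}|\le h|x_{0:t}|$ for all $t$. **Certainty equivalence controller.** $u_0=0$. For $t\ge 1$, after observing $x_t$, let $\bar a_t$ be a minimizer over $\hat a\in\mathbb R$ of $\sum_{s=0}^{t-1}(x_{s+1}-\hat a x_s-u_s)^2$; explicitly, with $X_t=\sum_{s=0}^{t-1}x_s^2$ and $Q_t=\sum_{s=0}^{t-1}(x_{s+1}-u_s)x_s$, $\bar a_t=Q_t/X_t$ if $X_t\ne0$ and $\bar a_t=0$ if $X_t=0$. Let $\hat a_t$ be the point of $[-M,M]$ closest to $\bar a_t$ (clipping), and play $u_t=-\hat a_tx_t$. **Gain.** $\ell_2\text{-gain}(\mathcal A)\le\gamma$ means $|x_{1:T}|\le\gamma|f_{0:T-1}|$ for every $T\ge1$, every $a\in[-M,M]$,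 every real-valued disturbance signal $f$, and every real-valued signal $w$ (possibly depending on past states) with $|w_{0:t}|\le h|x_{0:t}|$ for all $t\in\mathbb Z_+$. *)

theory Defs
  imports "HOL-Analysis.Analysis"
begin

type_synonym signal = "nat \<Rightarrow> real"

definition seg_norm :: "signal \<Rightarrow> nat \<Rightarrow> nat \<Rightarrow> real" where
  "seg_norm y s t = L2_set y {s..t}"

text \<open>A controller \<open>A\<close> yields the input \<open>A x u t\<close> at time \<open>t\<close>. It is meant to be causal, i.e. to
  use only \<open>x\<close> at times \<open>\<le> t\<close> and \<open>u\<close> at times \<open>< t\<close>.\<close>
type_synonym controller = "signal \<Rightarrow> signal \<Rightarrow> nat \<Rightarrow> real"

definition closed_loop ::
  "controller \<Rightarrow> real \<Rightarrow> signal \<Rightarrow> signal \<Rightarrow> signal \<Rightarrow> signal \<Rightarrow> bool" where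
  "closed_loop A a w f x u \<longleftrightarrow>
     x 0 = 0 \<and>
     (\<forall>t. x (Suc t) = a * x t + u t + w t + f t) \<and>
     (\<forall>t. u t = A x u t)"

text \<open>The quantification ranges over all closed-loop trajectories, so \<open>w\<close> and \<open>f\<close> are the realized
  values of the misspecification and disturbance; this includes the case where they are generated
  by feedback from past states.\<close>
definition l2_gain_le :: "real \<Rightarrow> real \<Rightarrow> controller \<Rightarrow> real \<Rightarrow> bool" where
  "l2_gain_le M h A \<gamma> \<longleftrightarrow>
     (\<forall>T\<ge>1. \<forall>a\<in>{-M..M}. \<forall>w f x u.
        closed_loop A a w f x u \<longrightarrow>
        (\<forall>t. seg_norm w 0 t \<le> h * seg_norm x 0 t) \<longrightarrow>
        seg_norm x 1 T \<le> \<gamma> * seg_norm f 0 (T - 1))"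

definition ls_estimate :: "signal \<Rightarrow> signal \<Rightarrow> nat \<Rightarrow> real" where
  "ls_estimate x u t =
     (let X = (\<Sum>s<t. (x s)\<^sup>2);
          Q = (\<Sum>s<t. (x (Suc s) - u s) * x s)
      in if X \<noteq> 0 then Q / X else 0)"

definition clipped_estimate :: "real \<Rightarrow> signal \<Rightarrow> signal \<Rightarrow> nat \<Rightarrow> real" where
  "clipped_estimate M x u t = closest_point {-M..M} (ls_estimate x u t)"

definition ce_controller :: "real \<Rightarrow> controller" where
  "ce_controller M x u t = (if t = 0 then 0 else - clipped_estimate M x u t * x t)"

lemma ls_estimate_minimizes:
  "is_arg_min (\<lambda>b. \<Sum>s<t. (x (Suc s) - b * x s - u s)\<^sup>2) (\<lambda>_. True) (ls_estimate x u t)"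
proof -
  define X where "X = (\<Sum>s<t. (x s)\<^sup>2)"
  define Q where "Q = (\<Sum>s<t. (x (Suc s) - u s) * x s)"
  define R where "R = (\<Sum>s<t. (x (Suc s) - u s)\<^sup>2)"
  have expand: "(\<Sum>s<t. (x (Suc s) - b * x s - u s)\<^sup>2) = R - 2 * b * Q + b\<^sup>2 * X" for b
    unfolding X_def Q_def R_def
    by (simp add: sum_distrib_left sum.distrib[symmetric] sum_subtractf[symmetric]
        power2_eq_square algebra_simps)
  have X0: "X \<ge> 0"
    unfolding X_def by (simp add: sum_nonneg)
  have est: "ls_estimate x u t = (if X \<noteq> 0 then Q / X else 0)"
    by (simp add: ls_estimate_def X_def Q_def)
  have "R - 2 * ls_estimate x u t * Q + (ls_estimate x u t)\<^sup>2 * X \<le> R - 2 * b * Q + b\<^sup>2 * X" for b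
  proof (cases "X = 0")
    case True
    then have "\<forall>s<t. x s = 0"
      unfolding X_def by (subst (asm) sum_nonneg_eq_0_iff) auto
    then have "Q = 0"
      unfolding Q_def by simp
    with True show ?thesis by simp
  next
    case False
    have "(R - 2 * b * Q + b\<^sup>2 * X) - (R - 2 * (Q / X) * Q + (Q / X)\<^sup>2 * X) = X * (b - Q / X)\<^sup>2"
      using False by (simp add: field_simps power2_eq_square)
    also have "\<dots> \<ge> 0"
      using X0 by simp
    finally show ?thesis
      using False by (simp add: est)
  qed
  then show ?thesis
    unfolding is_arg_min_linorder expand by simp
qed

lemma clipped_estimate_eq:
  assumes "M \<ge> 0"
  shows "clipped_estimate M x u t = max (-M) (min M (ls_estimate x u t))"
  unfolding clipped_estimate_def
  by (rule closest_point_unique[symmetric]) (use assms in \<open>auto simp: dist_real_def\<close>)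

lemma ce_controller_causal:
  assumes "\<And>s. s \<le> t \<Longrightarrow> x s = x' s" and "\<And>s. s < t \<Longrightarrow> u s = u' s"
  shows "ce_controller M x u t = ce_controller M x' u' t"
proof -
  have "ls_estimate x u t = ls_estimate x' u' t"
    using assms by (simp add: ls_estimate_def Suc_le_eq)
  then show ?thesis
    using assms(1)[of t] by (simp add: ce_controller_def clipped_estimate_def)
qed

end

theory Submission
  imports Defs
begin

text \<open>
  Put \<open>d = w + f\<close> and let \<open>K\<^sub>t\<close> be the estimation error \<open>a - \<close>(clipped estimate at time \<open>t\<close>). Certainty
  equivalence cancels the estimated part of the dynamics, so \<open>x\<^sub>t\<^sub>+\<^sub>1 = K\<^sub>t x\<^sub>t + d\<^sub>t\<close>. Write \<open>\<xi>\<^sub>n\<close> for the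
  energy norm of \<open>x\<close> strictly before time \<open>n\<close>, and \<open>\<phi>\<close> for the norm of \<open>f\<close> up to the horizon.

  Two facts about the estimator suffice: clipping gives \<open>\<bar>K\<^sub>t\<bar> \<le> 2M\<close>, and Cauchy-Schwarz on the normal
  equation gives \<open>\<bar>K\<^sub>t\<bar> \<xi>\<^sub>t \<le> \<phi> + h \<xi>\<^sub>t\<close>. Hence \<open>\<bar>K\<^sub>t\<bar> \<le> 1/2\<close> as soon as \<open>\<xi>\<^sub>t\<close> exceeds the level
  \<open>C = 2\<phi> / (1 - 2h)\<close>. If the error were always at most \<open>1/2\<close>, the triangle inequality
  \<open>\<xi> \<le> \<xi>/2 + h \<xi> + \<phi>\<close> would give \<open>\<xi> \<le> C\<close>. The cost of learning is thus measured by the excess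
  \<open>\<Sum> (K\<^sub>t\<^sup>2 - 1/4)\<^sup>+ x\<^sub>t\<^sup>2\<close>, and the heart of the proof (\<open>excess_energy_le\<close>) is that it never exceeds
  \<open>(4M\<^sup>2 - 1/4) C\<^sup>2\<close>. This is immediate while \<open>\<xi> \<le> C\<close>, and beyond \<open>C\<close> nothing is added. The
  single step that jumps across \<open>C\<close> may have a large \<open>x\<^sub>t\<close>, but a large jump forces \<open>\<xi>\<^sub>t\<close> to have
  been large already, which forces \<open>K\<^sub>t\<close> to be small (\<open>crossing_step\<close>). Inserting the excess bound
  into the triangle inequality leaves a quadratic inequality in \<open>\<xi>\<close>, whose solution
  (\<open>final_quadratic_bound\<close>) is the stated gain.
\<close>

section \<open>Energy of the past of a signal\<close>

abbreviation past_norm :: "signal \<Rightarrow> nat \<Rightarrow> real" where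
  "past_norm y n \<equiv> L2_set y {..<n}"

lemma past_norm_power2: "(past_norm y n)\<^sup>2 = (\<Sum>s<n. (y s)\<^sup>2)"
  by (simp add: L2_set_def sum_nonneg)

lemma past_norm_mono: "m \<le> n \<Longrightarrow> past_norm y m \<le> past_norm y n"
  unfolding L2_set_def by (intro real_sqrt_le_mono sum_mono2) auto

lemma past_norm_Suc_power2: "(past_norm y (Suc n))\<^sup>2 = (past_norm y n)\<^sup>2 + (y n)\<^sup>2"
  by (simp add: past_norm_power2)

lemma past_norm_Suc_shift:
  assumes "x 0 = 0"
  shows "past_norm x (Suc n) = past_norm (\<lambda>t. x (Suc t)) n"
  unfolding L2_set_def by (subst sum.lessThan_Suc_shift) (simp add: assms)

lemma past_norm_abs_le_mult:
  assumes "0 \<le> c" and "\<And>t. \<bar>y t\<bar> \<le> c * \<bar>x t\<bar>"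
  shows "past_norm y n \<le> c * past_norm x n"
proof -
  have "past_norm y n = past_norm (\<lambda>t. \<bar>y t\<bar>) n"
    by (simp add: L2_set_def)
  also have "\<dots> \<le> past_norm (\<lambda>t. c * \<bar>x t\<bar>) n"
    using assms by (intro L2_set_mono) auto
  also have "\<dots> = c * past_norm x n"
    using assms(1) by (simp add: L2_set_right_distrib[symmetric]) (simp add: L2_set_def)
  finally show ?thesis .
qed

lemma seg_norm_0_eq_past_norm: "seg_norm y 0 t = past_norm y (Suc t)"
  by (simp add: seg_norm_def atLeast0AtMost lessThan_Suc_atMost)

lemma seg_norm_1_eq_past_norm:
  assumes "y 0 = 0"
  shows "seg_norm y 1 T = past_norm y (Suc T)"
proof -
  have "(\<Sum>s=1..T. (y s)\<^sup>2) = (\<Sum>s<Suc T. (y s)\<^sup>2)"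
    using assms by (intro sum.mono_neutral_left) (auto simp: not_less_eq_eq)
  then show ?thesis
    by (simp only: seg_norm_def L2_set_def)
qed

section \<open>The estimation error in closed loop\<close>

lemma closed_loop_error_dynamics:
  assumes "closed_loop (ce_controller M) a w f x u"
  shows "x (Suc t) = (a - clipped_estimate M x u t) * x t + (w t + f t)"
  using assms by (cases "t = 0") (auto simp: closed_loop_def ce_controller_def algebra_simps)

lemma clipped_estimate_error_le:
  assumes "0 \<le> M" and "a \<in> {-M..M}"
  shows "\<bar>a - clipped_estimate M x u t\<bar> \<le> 2 * M"
    and "\<bar>a - clipped_estimate M x u t\<bar> \<le> \<bar>a - ls_estimate x u t\<bar>"
  using assms by (auto simp: clipped_estimate_eq)

text \<open>The normal equation says that the least squares error times \<open>\<Sum> x\<^sub>s\<^sup>2\<close> is the correlation of the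
  disturbance with the state; Cauchy-Schwarz then cancels one factor of the norm of \<open>x\<close>.\<close>
lemma ls_estimate_error_le:
  assumes "\<And>s. x (Suc s) = a * x s + u s + d s"
  shows "\<bar>a - ls_estimate x u t\<bar> * past_norm x t \<le> past_norm d t"
proof (cases "past_norm x t = 0")
  case False
  define y where "y = past_norm x t"
  have y: "y > 0"
    using False by (simp add: y_def less_le)
  have X: "(\<Sum>s<t. (x s)\<^sup>2) = y\<^sup>2"
    by (simp add: y_def past_norm_power2)
  have Q: "(\<Sum>s<t. (x (Suc s) - u s) * x s) = a * y\<^sup>2 + (\<Sum>s<t. d s * x s)"
    unfolding X[symmetric] sum_distrib_left sum.distrib[symmetric]
    by (intro sum.cong) (simp_all add: assms power2_eq_square algebra_simps)
  have "ls_estimate x u t = a + (\<Sum>s<t. d s * x s) / y\<^sup>2"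
    using y unfolding ls_estimate_def X Q by (simp add: add_divide_distrib)
  then have "\<bar>a - ls_estimate x u t\<bar> * y * y = \<bar>\<Sum>s<t. d s * x s\<bar>"
    using y by (simp add: abs_divide power2_eq_square)
  also have "\<dots> \<le> (\<Sum>s<t. \<bar>d s\<bar> * \<bar>x s\<bar>)"
    by (metis (no_types, lifting) abs_mult sum_abs sum.cong)
  also have "\<dots> \<le> past_norm d t * y"
    unfolding y_def by (rule L2_set_mult_ineq)
  finally show ?thesis
    using y by (simp add: y_def)
qed simp

section \<open>Energy carried by large estimation errors\<close>

text \<open>The step from norm \<open>y \<le> C\<close> to norm \<open>z > C\<close>, where \<open>\<delta>\<close> bounds the total disturbance so far. The
  choice of \<open>C\<close> gives \<open>2 \<delta> \<le> C\<close> as long as \<open>y \<le> C\<close>, so crossing requires \<open>2 M y > \<delta>\<close>: the past must already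
  be so large that \<open>\<bar>K\<bar> y \<le> \<delta>\<close> is sharper than \<open>\<bar>K\<bar> \<le> 2 M\<close>. Writing \<open>m = 2 M y\<close>, the claim
  times \<open>4 y\<^sup>2\<close> is the product of two inequalities, \<open>(2 K y)\<^sup>2 - y\<^sup>2 \<le> C\<^sup>2 - y\<^sup>2\<close> (from \<open>2 \<delta> \<le> C\<close>) and
  \<open>z\<^sup>2 - y\<^sup>2 \<le> (2 m)\<^sup>2 - y\<^sup>2\<close> (from \<open>\<delta> \<le> m\<close>).\<close>
lemma crossing_step:
  fixes M h C \<phi> \<delta> y z K :: real
  assumes h: "0 \<le> h" and \<phi>: "2 * \<phi> = (1 - 2 * h) * C" and \<delta>: "\<delta> = \<phi> + h * y"
    and y: "0 \<le> y" "y \<le> C" and z: "C < z" "z \<le> 2 * M * y + \<delta>"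
    and K: "1 / 2 < \<bar>K\<bar>" "\<bar>K\<bar> * y \<le> \<delta>"
  shows "(4 * M\<^sup>2 - 1 / 4) * y\<^sup>2 + (K\<^sup>2 - 1 / 4) * (z\<^sup>2 - y\<^sup>2) \<le> (4 * M\<^sup>2 - 1 / 4) * C\<^sup>2"
proof -
  define m where "m = 2 * M * y"
  have "2 * \<delta> = C - 2 * (h * (C - y))"
    using \<phi> \<delta> by (simp add: algebra_simps)
  moreover have "0 \<le> h * (C - y)"
    using h y by simp
  ultimately have \<delta>C: "2 * \<delta> \<le> C" by linarith
  with z have m: "\<delta> < m" by (simp add: m_def)
  have Ky: "y \<le> 2 * (\<bar>K\<bar> * y)"
    using K(1) y(1) mult_right_mono[of "1 / 2" "\<bar>K\<bar>" y] by simp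
  then have y\<delta>: "y \<le> 2 * \<delta>" using K(2) by linarith
  have \<delta>0: "0 \<le> \<delta>" using y\<delta> y(1) by linarith
  have y_pos: "0 < y"
    using m \<delta>0 y(1) by (cases "y = 0") (auto simp: m_def)
  have 1: "4 * (\<bar>K\<bar> * y)\<^sup>2 - y\<^sup>2 \<le> C\<^sup>2 - y\<^sup>2"
    using power_mono[of "2 * (\<bar>K\<bar> * y)" C 2] K(2) \<delta>C y(1) by (simp add: power_mult_distrib)
  have 2: "z\<^sup>2 - y\<^sup>2 \<le> 4 * m\<^sup>2 - y\<^sup>2"
    using power_mono[of z "2 * m" 2] z m y by (simp add: power_mult_distrib m_def)
  have 3: "0 \<le> z\<^sup>2 - y\<^sup>2" "0 \<le> C\<^sup>2 - y\<^sup>2"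
    using y z by (auto intro!: power_mono)
  have "y\<^sup>2 * (4 * ((K\<^sup>2 - 1 / 4) * (z\<^sup>2 - y\<^sup>2))) = (4 * (\<bar>K\<bar> * y)\<^sup>2 - y\<^sup>2) * (z\<^sup>2 - y\<^sup>2)"
    by (simp add: power_mult_distrib algebra_simps)
  also have "\<dots> \<le> (C\<^sup>2 - y\<^sup>2) * (4 * m\<^sup>2 - y\<^sup>2)"
    using 1 2 3 by (intro mult_mono) auto
  also have "\<dots> = y\<^sup>2 * (4 * ((4 * M\<^sup>2 - 1 / 4) * (C\<^sup>2 - y\<^sup>2)))"
    by (simp add: m_def power_mult_distrib algebra_simps)
  finally have "4 * ((K\<^sup>2 - 1 / 4) * (z\<^sup>2 - y\<^sup>2)) \<le> 4 * ((4 * M\<^sup>2 - 1 / 4) * (C\<^sup>2 - y\<^sup>2))"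
    using y_pos by simp
  then show ?thesis by (simp add: algebra_simps)
qed

text \<open>Induction on the horizon. Carrying the bound by the current norm alongside the bound by \<open>C\<close> is
  what leaves room for the crossing step.\<close>
lemma excess_energy_le:
  fixes M h C \<phi> :: real and x K d :: signal
  assumes M: "1 / 4 \<le> M" and h: "0 \<le> h" "h < 1 / 2"
    and C: "0 \<le> C" and \<phi>: "2 * \<phi> = (1 - 2 * h) * C"
    and x0: "x 0 = 0" and dyn: "\<And>t. x (Suc t) = K t * x t + d t"
    and d: "\<And>n. n \<le> T \<Longrightarrow> past_norm d n \<le> \<phi> + h * past_norm x n"
    and K2M: "\<And>t. \<bar>K t\<bar> \<le> 2 * M"
    and Kx: "\<And>t. \<bar>K t\<bar> * past_norm x t \<le> past_norm d t"
    and n: "n \<le> T"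
  shows "(\<Sum>t<n. max 0 ((K t)\<^sup>2 - 1 / 4) * (x t)\<^sup>2)
    \<le> (4 * M\<^sup>2 - 1 / 4) * min ((past_norm x n)\<^sup>2) (C\<^sup>2)"
  using n
proof (induction n)
  case 0
  then show ?case by simp
next
  case (Suc n)
  define S where "S = (\<Sum>t<n. max 0 ((K t)\<^sup>2 - 1 / 4) * (x t)\<^sup>2)"
  define B where "B = 4 * M\<^sup>2 - 1 / 4"
  define y where "y = past_norm x n"
  define z where "z = past_norm x (Suc n)"
  have y: "0 \<le> y" by (simp add: y_def)
  have z_sq: "z\<^sup>2 = y\<^sup>2 + (x n)\<^sup>2"
    by (simp add: y_def z_def past_norm_Suc_power2)
  have yz: "y \<le> z" by (simp add: y_def z_def past_norm_mono)
  have B: "0 \<le> B"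
    using power_mono[of "1 / 4" M 2] M by (simp add: B_def power2_eq_square)
  have IH: "S \<le> B * min (y\<^sup>2) (C\<^sup>2)"
    using Suc by (simp add: S_def B_def y_def)
  have KB: "max 0 ((K n)\<^sup>2 - 1 / 4) \<le> B"
    using power_mono[OF K2M[of n], of 2] B by (simp add: B_def power_mult_distrib)
  have Ky: "\<bar>K n\<bar> * y \<le> \<phi> + h * y"
    using Kx[of n] d[of n] Suc.prems by (simp add: y_def)
  have goal: "S + max 0 ((K n)\<^sup>2 - 1 / 4) * (x n)\<^sup>2 \<le> B * min (z\<^sup>2) (C\<^sup>2)"
  proof (cases "z \<le> C")
    case True
    have "S \<le> B * y\<^sup>2"
      using IH B by (meson min.cobounded1 mult_left_mono order_trans)
    moreover have "max 0 ((K n)\<^sup>2 - 1 / 4) * (x n)\<^sup>2 \<le> B * (x n)\<^sup>2"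
      using KB by (intro mult_right_mono) auto
    moreover have "min (z\<^sup>2) (C\<^sup>2) = z\<^sup>2"
      using True y yz by (simp add: min_absorb1 power_mono)
    ultimately show ?thesis by (simp add: z_sq algebra_simps)
  next
    case zC: False
    then have min_z: "min (z\<^sup>2) (C\<^sup>2) = C\<^sup>2"
      using C by (simp add: min_absorb2 power_mono)
    have S: "S \<le> B * y\<^sup>2" "S \<le> B * C\<^sup>2"
      using IH B by (meson min.cobounded1 min.cobounded2 mult_left_mono order_trans)+
    show ?thesis
    proof (cases "\<bar>K n\<bar> \<le> 1 / 2")
      case True
      then have "(K n)\<^sup>2 \<le> 1 / 4"
        using power_mono[of "\<bar>K n\<bar>" "1 / 2" 2] by (simp add: power2_eq_square)
      then show ?thesis using S min_z by simp
    next
      case False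
      then have K: "1 / 2 < \<bar>K n\<bar>" by simp
      have "1 / 2 * y \<le> \<bar>K n\<bar> * y"
        using K y by (intro mult_right_mono) auto
      then have "(1 - 2 * h) * y \<le> (1 - 2 * h) * C"
        using Ky \<phi> by (simp add: algebra_simps)
      then have yC: "y \<le> C" using h by simp
      have "z = past_norm (\<lambda>t. K t * x t + d t) n"
        by (simp add: z_def past_norm_Suc_shift[of x, OF x0] dyn)
      also have "\<dots> \<le> past_norm (\<lambda>t. K t * x t) n + past_norm d n"
        by (rule L2_set_triangle_ineq)
      also have "past_norm (\<lambda>t. K t * x t) n \<le> 2 * M * y"
        unfolding y_def using M K2M
        by (intro past_norm_abs_le_mult) (auto simp: abs_mult intro!: mult_right_mono)
      also have "past_norm d n \<le> \<phi> + h * y"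
        using d[of n] Suc.prems by (simp add: y_def)
      finally have z: "z \<le> 2 * M * y + (\<phi> + h * y)" by simp
      have "B * y\<^sup>2 + ((K n)\<^sup>2 - 1 / 4) * (z\<^sup>2 - y\<^sup>2) \<le> B * C\<^sup>2"
        unfolding B_def by (rule crossing_step[OF h(1) \<phi> refl y yC _ z K Ky]) (use zC in simp)
      moreover have "max 0 ((K n)\<^sup>2 - 1 / 4) = (K n)\<^sup>2 - 1 / 4"
        using power_mono[of "1 / 2" "\<bar>K n\<bar>" 2] K by (simp add: power2_eq_square)
      ultimately show ?thesis
        using S min_z z_sq by simp
    qed
  qed
  then show ?case
    by (simp add: S_def B_def z_def)
qed

section \<open>The gain bound\<close>

text \<open>Squaring the hypothesis and putting \<open>q = 1/2 - h\<close> gives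
  \<open>q (\<xi> - C) ((1 + q) \<xi> - q C) \<le> (4M\<^sup>2 - 1/4) C\<^sup>2\<close>; for \<open>\<xi> > C\<close> the last factor on the left is at
  least \<open>(\<xi> + C) / 2\<close>, which turns it into a bound on \<open>\<xi>\<^sup>2 - C\<^sup>2\<close>.\<close>
lemma final_quadratic_bound:
  fixes M h C \<phi> \<xi> :: real
  assumes M: "1 / 4 \<le> M" and h: "h < 1 / 2"
    and \<phi>: "2 * \<phi> = (1 - 2 * h) * C" and \<xi>: "0 \<le> \<xi>"
    and main: "\<xi> \<le> sqrt (\<xi>\<^sup>2 / 4 + (4 * M\<^sup>2 - 1 / 4) * C\<^sup>2) + (\<phi> + h * \<xi>)"
  shows "(1 - 2 * h) * (\<xi>\<^sup>2 - C\<^sup>2) \<le> (16 * M\<^sup>2 - 1) * C\<^sup>2"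
proof -
  have M2: "0 \<le> 16 * M\<^sup>2 - 1"
    using power_mono[of "1 / 4" M 2] M by (simp add: power2_eq_square)
  show ?thesis
  proof (cases "\<xi> \<le> C")
    case True
    then have "(1 - 2 * h) * (\<xi>\<^sup>2 - C\<^sup>2) \<le> 0"
      using h \<xi> by (intro mult_nonneg_nonpos) (auto intro: power_mono)
    moreover have "0 \<le> (16 * M\<^sup>2 - 1) * C\<^sup>2" using M2 by simp
    ultimately show ?thesis by linarith
  next
    case False
    define q where "q = 1 / 2 - h"
    have q: "0 < q" using h by (simp add: q_def)
    have hq: "h = 1 / 2 - q" by (simp add: q_def)
    have \<phi>q: "\<phi> = q * C" using \<phi> by (simp add: q_def algebra_simps)
    have "0 \<le> q * (\<xi> - C)" using q False by simp
    then have pos: "0 \<le> (1 / 2 + q) * \<xi> - q * C"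
      using \<xi> by (simp add: algebra_simps)
    have rad: "0 \<le> \<xi>\<^sup>2 / 4 + (4 * M\<^sup>2 - 1 / 4) * C\<^sup>2"
      using M2 by simp
    have "(1 / 2 + q) * \<xi> - q * C \<le> sqrt (\<xi>\<^sup>2 / 4 + (4 * M\<^sup>2 - 1 / 4) * C\<^sup>2)"
      using main by (simp add: hq \<phi>q algebra_simps)
    then have "((1 / 2 + q) * \<xi> - q * C)\<^sup>2 \<le> \<xi>\<^sup>2 / 4 + (4 * M\<^sup>2 - 1 / 4) * C\<^sup>2"
      using power_mono[OF _ pos, of _ 2] rad by fastforce
    moreover have "((1 / 2 + q) * \<xi> - q * C)\<^sup>2 - \<xi>\<^sup>2 / 4
        = q * (\<xi>\<^sup>2 - C\<^sup>2) / 2 + q * (1 / 2 + q) * (\<xi> - C)\<^sup>2"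
      by (simp add: power2_eq_square field_simps)
    moreover have "0 \<le> q * (1 / 2 + q) * (\<xi> - C)\<^sup>2"
      using q by simp
    ultimately have "q * (\<xi>\<^sup>2 - C\<^sup>2) / 2 \<le> (4 * M\<^sup>2 - 1 / 4) * C\<^sup>2"
      by linarith
    moreover have "1 - 2 * h = 2 * q" by (simp add: q_def)
    ultimately show ?thesis by (simp add: left_diff_distrib)
  qed
qed

theorem theorem14:
  fixes M h :: real
  assumes "M \<ge> 1 / 4" and "0 \<le> h" and "h < 1 / 2"
  shows "l2_gain_le M h (ce_controller M) (sqrt (64 * M\<^sup>2 - 8 * h) / (1 - 2 * h) powr (3 / 2))"
  unfolding l2_gain_le_def
proof (intro allI impI ballI)
  fix T :: nat and a :: real and w f x u :: signal
  assume T: "1 \<le> T" and a: "a \<in> {-M..M}"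
    and loop: "closed_loop (ce_controller M) a w f x u"
    and w: "\<forall>t. seg_norm w 0 t \<le> h * seg_norm x 0 t"
  define d where "d = (\<lambda>t. w t + f t)"
  define K where "K = (\<lambda>t. a - clipped_estimate M x u t)"
  define \<phi> where "\<phi> = past_norm f T"
  define e where "e = 1 - 2 * h"
  define C where "C = 2 * \<phi> / e"
  define \<xi> where "\<xi> = past_norm x (Suc T)"
  have e: "0 < e" using assms by (simp add: e_def)
  have \<phi>0: "0 \<le> \<phi>" by (simp add: \<phi>_def)
  have C: "0 \<le> C" "2 * \<phi> = (1 - 2 * h) * C"
    using e \<phi>0 by (simp_all add: C_def e_def)
  have x0: "x 0 = 0" using loop by (simp add: closed_loop_def)
  have dyn: "x (Suc t) = K t * x t + d t" for t
    using closed_loop_error_dynamics[OF loop] by (simp add: K_def d_def)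
  have wx: "past_norm w n \<le> h * past_norm x n" for n
    using w by (cases n) (auto simp: seg_norm_0_eq_past_norm)
  have d_le: "past_norm d n \<le> \<phi> + h * past_norm x n" if "n \<le> T" for n
  proof -
    have "past_norm d n \<le> past_norm w n + past_norm f n"
      unfolding d_def by (rule L2_set_triangle_ineq)
    then show ?thesis
      using wx[of n] past_norm_mono[OF that, of f] by (simp add: \<phi>_def)
  qed
  have K2M: "\<bar>K t\<bar> \<le> 2 * M" for t
    unfolding K_def using assms a by (intro clipped_estimate_error_le) auto
  have Kx: "\<bar>K t\<bar> * past_norm x t \<le> past_norm d t" for t
  proof -
    have "\<bar>K t\<bar> * past_norm x t \<le> \<bar>a - ls_estimate x u t\<bar> * past_norm x t"
      unfolding K_def using assms a by (intro mult_right_mono clipped_estimate_error_le) auto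
    also have "\<dots> \<le> past_norm d t"
      using loop by (intro ls_estimate_error_le) (auto simp: closed_loop_def d_def)
    finally show ?thesis .
  qed
  define S where "S = (\<Sum>t<T. max 0 ((K t)\<^sup>2 - 1 / 4) * (x t)\<^sup>2)"
  have M2: "0 \<le> 4 * M\<^sup>2 - 1 / 4"
    using power_mono[of "1 / 4" M 2] assms by (simp add: power2_eq_square)
  have "S \<le> (4 * M\<^sup>2 - 1 / 4) * min ((past_norm x T)\<^sup>2) (C\<^sup>2)"
    unfolding S_def
    by (rule excess_energy_le[where d = d, OF assms C x0 dyn d_le K2M Kx order_refl])
  also have "\<dots> \<le> (4 * M\<^sup>2 - 1 / 4) * C\<^sup>2"
    using M2 by (intro mult_left_mono) auto
  finally have S: "S \<le> (4 * M\<^sup>2 - 1 / 4) * C\<^sup>2" .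
  have xT: "past_norm x T \<le> \<xi>" by (simp add: \<xi>_def past_norm_mono)
  have "(past_norm (\<lambda>t. K t * x t) T)\<^sup>2 = (\<Sum>t<T. (K t)\<^sup>2 * (x t)\<^sup>2)"
    by (simp add: past_norm_power2 power_mult_distrib)
  also have "\<dots> \<le> (\<Sum>t<T. (1 / 4 + max 0 ((K t)\<^sup>2 - 1 / 4)) * (x t)\<^sup>2)"
    by (intro sum_mono mult_right_mono) auto
  also have "\<dots> = (past_norm x T)\<^sup>2 / 4 + S"
    by (simp add: S_def past_norm_power2 distrib_right sum.distrib sum_divide_distrib)
  also have "\<dots> \<le> \<xi>\<^sup>2 / 4 + (4 * M\<^sup>2 - 1 / 4) * C\<^sup>2"
    using S power_mono[OF xT, of 2] by simp
  finally have Kx_norm: "past_norm (\<lambda>t. K t * x t) T \<le> sqrt (\<xi>\<^sup>2 / 4 + (4 * M\<^sup>2 - 1 / 4) * C\<^sup>2)"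
    by (rule real_le_rsqrt)
  have "\<xi> = past_norm (\<lambda>t. K t * x t + d t) T"
    by (simp add: \<xi>_def past_norm_Suc_shift[of x, OF x0] dyn)
  also have "\<dots> \<le> past_norm (\<lambda>t. K t * x t) T + past_norm d T"
    by (rule L2_set_triangle_ineq)
  also have "past_norm d T \<le> \<phi> + h * \<xi>"
    using d_le[of T] mult_left_mono[OF xT, of h] assms by simp
  finally have "\<xi> \<le> sqrt (\<xi>\<^sup>2 / 4 + (4 * M\<^sup>2 - 1 / 4) * C\<^sup>2) + (\<phi> + h * \<xi>)"
    using Kx_norm by simp
  then have "e * (\<xi>\<^sup>2 - C\<^sup>2) \<le> (16 * M\<^sup>2 - 1) * C\<^sup>2"
    unfolding e_def by (intro final_quadratic_bound[OF assms(1,3) C(2)]) (auto simp: \<xi>_def)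
  then have "e * \<xi>\<^sup>2 \<le> (e + 16 * M\<^sup>2 - 1) * C\<^sup>2"
    by (simp add: algebra_simps)
  then have "\<xi>\<^sup>2 \<le> (e + 16 * M\<^sup>2 - 1) * C\<^sup>2 / e"
    using e by (simp add: pos_le_divide_eq mult.commute)
  also have "\<dots> = (64 * M\<^sup>2 - 8 * h) / e ^ 3 * \<phi>\<^sup>2"
    using e by (simp add: C_def power2_eq_square power3_eq_cube) (simp add: e_def algebra_simps)
  finally have "\<xi> \<le> sqrt ((64 * M\<^sup>2 - 8 * h) / e ^ 3 * \<phi>\<^sup>2)"
    by (rule real_le_rsqrt)
  also have "\<dots> = sqrt (64 * M\<^sup>2 - 8 * h) / sqrt (e ^ 3) * \<phi>"
    using \<phi>0 by (simp add: real_sqrt_mult real_sqrt_divide)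
  also have "sqrt (e ^ 3) = e powr (3 / 2)"
    using e by (simp add: powr_half_sqrt[symmetric] powr_powr flip: powr_numeral)
  finally have "\<xi> \<le> sqrt (64 * M\<^sup>2 - 8 * h) / e powr (3 / 2) * \<phi>" .
  moreover have "seg_norm x 1 T = \<xi>"
    using seg_norm_1_eq_past_norm[of x, OF x0] by (simp add: \<xi>_def)
  moreover have "seg_norm f 0 (T - 1) = \<phi>"
    using T by (simp add: seg_norm_0_eq_past_norm \<phi>_def)
  ultimately show "seg_norm x 1 T
      \<le> sqrt (64 * M\<^sup>2 - 8 * h) / (1 - 2 * h) powr (3 / 2) * seg_norm f 0 (T - 1)"
    by (simp add: e_def)
qed

end
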